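(* Let $\mathbb{C}[[t]]=\{\sum_{i=0}^{\infty}a_it^i\mid a_i\in\mathbb{C}\}$ be the algebra of formal power series. The derivation algebra of $\mathbb{C}[[t]]$ is $\mathrm{Der}\,\mathbb{C}[[t]]=\mathbb{C}[[t]]\frac{d}{dt}$.
   Context: For an algebra $\mathcal{A}$ over $\mathbb{C}$, a derivation is a $\mathbb{C}$-linear map $D:\mathcal{A}\to\mathcal{A}$ with $D(xy)=D(x)y+xD(y)$ for all $x,y\in\mathcal{A}$ (no continuity is assumed); $\mathrm{Der}\,\mathcal{A}$ is the space of all derivations, a Lie algebra under $[D_1,D_2]=D_1D_2-D_2D_1$. For $p(t)\in\mathbb{C}[[t]]$, $p(t)\frac{d}{dt}$ denotes the derivation $a(t)\mapsto p(t)\frac{d}{dt}a(t)$, where $\frac{d}{dt}$ is formal differentiation, and $\mathbb{C}[[t]]\frac{d}{dt}=\{p(t)\frac{d}{dt}\mid p(t)\in\mathbb{C}[[t]]\}$. *)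

theory Defs
  imports Complex_Main "HOL-Computational_Algebra.Formal_Power_Series"
begin

text \<open>
  An algebra over the field of scalars is a ring type together with an explicit scalar
  multiplication \<open>scale\<close>; the predicate \<^const>\<open>Vector_Spaces.linear\<close> includes
  the vector space axioms for \<open>scale\<close>.
\<close>
definition Der :: "('k::field \<Rightarrow> 'a::ring \<Rightarrow> 'a) \<Rightarrow> ('a \<Rightarrow> 'a) set" where
  "Der scale = {D. Vector_Spaces.linear scale scale D \<and> (\<forall>x y. D (x * y) = D x * y + x * D y)}"

definition fps_scale :: "'k::field \<Rightarrow> 'k fps \<Rightarrow> 'k fps" where
  "fps_scale c f = fps_const c * f"

lemma fps_nth_fps_scale: "fps_nth (fps_scale c f) n = c * fps_nth f n"
  by (simp add: fps_scale_def)

lemma vector_space_fps_scale: "vector_space fps_scale"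
  by unfold_locales
    (simp_all add: fps_scale_def algebra_simps flip: fps_const_add fps_const_mult)

lemma fps_scale_mult:
  "fps_scale c f * g = fps_scale c (f * g)" "f * fps_scale c g = fps_scale c (f * g)"
  by (simp_all add: fps_scale_def algebra_simps)

end

theory Submission
  imports Defs
begin

text \<open>
  Without continuity, a derivation \<open>D\<close> is not obviously determined by \<open>D t\<close>, since knowing it on
  polynomials says nothing a priori about infinite sums. The remedy is that every series is a
  constant plus \<open>t\<close> times another series. Put \<open>p = D t\<close>; then \<open>E = D - p d/dt\<close> is a derivation that
  kills the constants and \<open>t\<close>, so \<open>f = c + t g\<close> gives \<open>E f = t \<cdot> E g\<close>. Iterating, \<open>E f\<close> is divisible
  by every power of \<open>t\<close>, hence is \<open>0\<close>. This is \<open>derivation_eq_0_if_kills_fps_X\<close>, and it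
  carries the whole argument, over any field of coefficients.
\<close>

lemma DerD:
  assumes "D \<in> Der scale"
  shows "D (x + y) = D x + D y" "D (scale c x) = scale c (D x)" "D (x * y) = D x * y + x * D y"
proof -
  have "Vector_Spaces.linear scale scale D"
    using assms by (simp add: Der_def)
  then interpret Vector_Spaces.linear scale scale D .
  show "D (x + y) = D x + D y" "D (scale c x) = scale c (D x)"
    by (simp_all add: add scale)
  show "D (x * y) = D x * y + x * D y"
    using assms by (simp add: Der_def)
qed

lemma Der_diff:
  assumes "D \<in> Der scale" "E \<in> Der scale"
  shows "(\<lambda>x. D x - E x) \<in> Der scale"
proof -
  have D: "Vector_Spaces.linear scale scale D" and E: "Vector_Spaces.linear scale scale E"
    using assms by (simp_all add: Der_def)
  interpret Vector_Spaces.linear scale scale D by (fact D)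
  have "Vector_Spaces.linear scale scale (\<lambda>x. D x - E x)"
    using vs1.vector_space_axioms vector_space_pair.linear_compose_sub[OF _ D E]
    by (simp add: vector_space_pair_def)
  then show ?thesis
    by (simp add: Der_def DerD(3)[OF assms(1)] DerD(3)[OF assms(2)] algebra_simps)
qed

lemma mult_fps_deriv_in_Der: "(\<lambda>a. p * fps_deriv a) \<in> Der fps_scale"
proof -
  have "Vector_Spaces.linear fps_scale fps_scale (\<lambda>a. p * fps_deriv a)"
    unfolding Vector_Spaces.linear_iff
    by (simp add: vector_space_fps_scale) (simp add: fps_scale_def algebra_simps)
  then show ?thesis
    by (simp add: Der_def algebra_simps)
qed

lemma derivation_fps_const:
  assumes "D \<in> Der fps_scale"
  shows "D (fps_const c) = 0"
proof -
  have "D 1 = 0"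
    using DerD(3)[OF assms, of 1 1]
    by (simp only: mult_1_left mult_1_right add_cancel_right_right)
  then show ?thesis
    using DerD(2)[OF assms, of c 1] by (simp add: fps_scale_def)
qed

text \<open>
  The induction is on the index of the coefficient, simultaneously for all series: multiplication by
  \<open>t\<close> reduces a coefficient of \<open>E f\<close> to the previous coefficient of \<open>E g\<close> for the shifted series \<open>g\<close>.
\<close>

lemma derivation_eq_0_if_kills_fps_X:
  assumes E: "E \<in> Der fps_scale" and X: "E fps_X = 0"
  shows "E f = 0"
proof -
  have step: "E f = fps_X * E (fps_shift 1 f)" for f
  proof -
    have "f = fps_const (fps_nth f 0) + fps_X * fps_shift 1 f"
      by (auto simp: fps_eq_iff)
    then have "E f = E (fps_const (fps_nth f 0) + fps_X * fps_shift 1 f)"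
      by (rule arg_cong)
    also have "\<dots> = fps_X * E (fps_shift 1 f)"
      by (simp only: DerD(1,3)[OF E] derivation_fps_const[OF E] X mult_zero_left add_0)
    finally show ?thesis .
  qed
  have "fps_nth (E f) n = 0" for n
  proof (induction n arbitrary: f)
    case 0
    show ?case by (subst step) simp
  next
    case (Suc n)
    then show ?case by (subst step) simp
  qed
  then show ?thesis
    by (simp add: fps_eq_iff)
qed

theorem theorem2p1:
  shows "Der (fps_scale :: complex \<Rightarrow> complex fps \<Rightarrow> complex fps) =
    {(\<lambda>a. p * fps_deriv a) | p. True}"
proof (intro Set.equalityI subsetI)
  fix D :: "complex fps \<Rightarrow> complex fps"
  assume "D \<in> Der fps_scale"
  then have "(\<lambda>a. D a - D fps_X * fps_deriv a) \<in> Der fps_scale"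
    by (intro Der_diff mult_fps_deriv_in_Der)
  then have "D a - D fps_X * fps_deriv a = 0" for a
    by (rule derivation_eq_0_if_kills_fps_X) simp
  then have "D a = D fps_X * fps_deriv a" for a
    by (rule right_minus_eq[THEN iffD1])
  then have "D = (\<lambda>a. D fps_X * fps_deriv a)"
    by (rule ext)
  then show "D \<in> {(\<lambda>a. p * fps_deriv a) | p. True}"
    by blast
next
  fix D :: "complex fps \<Rightarrow> complex fps"
  assume "D \<in> {(\<lambda>a. p * fps_deriv a) | p. True}"
  then show "D \<in> Der fps_scale"
    using mult_fps_deriv_in_Der by blast
qed

end
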